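(* Let $\hat{B}^{ns}_k[\cdot]$ be the nonsymmetric nonlinear AMLI-cycle multigrid operator and let $\tilde{B}^{ns}_k[\cdot]$ be given by $n\ge1$ steps of the (full) nonlinear PCG method with $\hat{B}^{ns}_k[\cdot]$ as the preconditioner. Assume that the convergence factor of the two-grid method is bounded by some $\bar\delta\in[0,1)$ independent of $k$, i.e. $\|(I-P_{k-1})(I-R_kA_k)v\|_{A_k}^2\le\bar\delta\,\|v\|_{A_k}^2$ for all $2\le k\le J$ and all $v\in V_k$. Let $n$ be chosen such that the inequality $$(1-\delta^n)\bar{\delta} + \delta^n \leq \delta$$ has a solution $\delta\in[0,1)$; a sufficient condition for the existence of such a solution is $n>\frac{1}{1-\bar\delta}$. Then, for such a $\delta$ (independent of $k$), for every $k\in\{1,\dots,J\}$ and every $v\in V_k$, $$\| v - \hat{B}^{ns}_k[A_kv] \|_{A_k}^2 \leq \delta \| v \|_{A_k}^2,\qquad \| v - \tilde{B}^{ns}_k[A_kv] \|_{A_k}^2 \leq \delta^n \| v \|_{A_k}^2.$$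
   Context: Setting. $V$ is a finite-dimensional real vector space with inner product $(\cdot,\cdot)$ and norm $\|\cdot\|$; $A:V\to V$ is symmetric positive definite (SPD) with respect to $(\cdot,\cdot)$; $(u,v)_A=(Au,v)$. $V_1\subset V_2\subset\cdots\subset V_J=V$ are nested subspaces. $Q_k,P_k:V\to V_k$ are the orthogonal projections with respect to $(\cdot,\cdot)$ and $(\cdot,\cdot)_A$. $A_k:V_k\to V_k$ is defined by $(A_ku_k,v_k)=(u_k,v_k)_A$ for $u_k,v_k\in V_k$; it is SPD, $(u,v)_{A_k}=(A_ku,v)$, with norm $\|\cdot\|_{A_k}$ (also used for the induced operator norm). $R_k:V_k\to V_k$ ($2\le k\le J$) are given linear smoothers, always assumed convergent: $\|I-R_kA_k\|_{A_k}<1$. The two-grid method at level $k$ is smoothing by $R_k$ combined with exact solution at level $k-1$; without post-smoothing its error operator is $(I-P_{k-1})(I-R_kA_k)$, and its convergence factor is measured in the squared energy norm. Nonlinear PCG ($n$ steps, full version, $n\ge1$ fixed) on $V_k$ with a given, possibly nonlinear, preconditioner $\hat B_k[\cdot]:V_k\to V_k$: for $f\in V_k$ put $u_0=0$, $r_0=f$, $p_0=\hat B_k[r_0]$; for $i=1,\dots,n-1$, $p_i=\hat B_k[r_i]+\sum_{j=0}^{i-1}\beta_{i,j}p_j$ with $\beta_{i,j}=-(\hat B_k[r_i],p_j)_{A_k}/(p_j,p_j)_{A_k}$; for $i=0,\dots,n-1$, $\alpha_i=(r_i,p_i)/(p_i,p_i)_{A_k}$, $u_{i+1}=u_i+\alpha_ip_i$,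 $r_{i+1}=r_i-\alpha_iA_kp_i$. The output is $\tilde B_k[f]:=u_n$. Convention: a coefficient $\alpha_i$ or $\beta_{i,j}$ whose denominator vanishes is taken to be $0$. Nonsymmetric nonlinear AMLI-cycle: $\hat B_1^{ns}[f]=A_1^{-1}f$ and, for $k\ge2$, $f\in V_k$, with $u_1=R_kf$: $\hat B_k^{ns}[f]=u_1+\tilde B_{k-1}^{ns}[Q_{k-1}(f-A_ku_1)]$, where on each level $\tilde B_{j}^{ns}[\cdot]$ is the operator produced by $n$ steps of nonlinear PCG on $V_{j}$ with preconditioner $\hat B_{j}^{ns}[\cdot]$. *)

theory Defs
  imports "HOL-Analysis.Analysis"
begin

definition spd :: "('a::real_inner \<Rightarrow> 'a) \<Rightarrow> bool" where
  "spd A \<longleftrightarrow> linear A \<and> (\<forall>u v. A u \<bullet> v = u \<bullet> A v) \<and> (\<forall>v. v \<noteq> 0 \<longrightarrow> 0 < A v \<bullet> v)"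

definition form :: "('a::real_inner \<Rightarrow> 'a) \<Rightarrow> 'a \<Rightarrow> 'a \<Rightarrow> real" where
  "form A u v = A u \<bullet> v"

definition enorm :: "('a::real_inner \<Rightarrow> 'a) \<Rightarrow> 'a \<Rightarrow> real" where
  "enorm A v = sqrt (form A v v)"

text \<open>Operators on a subspace \<open>S\<close> are functions on the ambient type of which only the
  values on \<open>S\<close> are relevant.\<close>

definition linear_op_on :: "'a::real_vector set \<Rightarrow> ('a \<Rightarrow> 'a) \<Rightarrow> bool" where
  "linear_op_on S T \<longleftrightarrow>
     (\<forall>v\<in>S. T v \<in> S) \<and>
     (\<forall>u\<in>S. \<forall>v\<in>S. T (u + v) = T u + T v) \<and>
     (\<forall>c. \<forall>v\<in>S. T (c *\<^sub>R v) = c *\<^sub>R T v)"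

text \<open>Operator norm on \<open>S\<close> induced by \<open>N\<close>, in the style of \<^const>\<open>onorm\<close>; the vector \<open>0\<close>
  contributes \<open>0 / 0 = 0\<close>.\<close>

definition opnorm_on :: "'a set \<Rightarrow> ('a \<Rightarrow> real) \<Rightarrow> ('a \<Rightarrow> 'a) \<Rightarrow> real" where
  "opnorm_on S N T = (SUP v\<in>S. N (T v) / N v)"

definition orth_proj :: "('a::real_vector \<Rightarrow> 'a \<Rightarrow> real) \<Rightarrow> 'a set \<Rightarrow> 'a \<Rightarrow> 'a" where
  "orth_proj b S v = (THE w. w \<in> S \<and> (\<forall>s\<in>S. b (v - w) s = 0))"

definition proj_Q :: "(nat \<Rightarrow> 'a::real_inner set) \<Rightarrow> nat \<Rightarrow> 'a \<Rightarrow> 'a" where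
  "proj_Q V k = orth_proj (\<bullet>) (V k)"

definition proj_P :: "(nat \<Rightarrow> 'a::real_inner set) \<Rightarrow> ('a \<Rightarrow> 'a) \<Rightarrow> nat \<Rightarrow> 'a \<Rightarrow> 'a" where
  "proj_P V A k = orth_proj (form A) (V k)"

text \<open>\<open>level_op V A k\<close> is $A_k$; it is meaningful on \<open>V k\<close>.\<close>

definition level_op :: "(nat \<Rightarrow> 'a::real_inner set) \<Rightarrow> ('a \<Rightarrow> 'a) \<Rightarrow> nat \<Rightarrow> 'a \<Rightarrow> 'a" where
  "level_op V A k u = (THE w. w \<in> V k \<and> (\<forall>v\<in>V k. w \<bullet> v = form A u v))"

definition smoother_error ::
    "(nat \<Rightarrow> 'a::real_inner set) \<Rightarrow> ('a \<Rightarrow> 'a) \<Rightarrow> (nat \<Rightarrow> 'a \<Rightarrow> 'a) \<Rightarrow> nat \<Rightarrow> 'a \<Rightarrow> 'a" where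
  "smoother_error V A R k v = v - R k (level_op V A k v)"

definition two_grid_error ::
    "(nat \<Rightarrow> 'a::real_inner set) \<Rightarrow> ('a \<Rightarrow> 'a) \<Rightarrow> (nat \<Rightarrow> 'a \<Rightarrow> 'a) \<Rightarrow> nat \<Rightarrow> 'a \<Rightarrow> 'a" where
  "two_grid_error V A R k v =
     (let w = smoother_error V A R k v in w - proj_P V A (k - 1) w)"

text \<open>Full nonlinear PCG for the operator \<open>A\<close>, preconditioner \<open>B\<close> and right-hand side \<open>f\<close>.
  Since \<open>x / 0 = 0\<close>, coefficients with vanishing denominator are \<open>0\<close>.\<close>

definition pcg_alpha :: "('a::real_inner \<Rightarrow> 'a) \<Rightarrow> 'a \<Rightarrow> 'a \<Rightarrow> real" where
  "pcg_alpha A r p = (r \<bullet> p) / form A p p"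

definition pcg_beta :: "('a::real_inner \<Rightarrow> 'a) \<Rightarrow> 'a \<Rightarrow> 'a \<Rightarrow> real" where
  "pcg_beta A z p = - form A z p / form A p p"

function
  pcg_res :: "('a::real_inner \<Rightarrow> 'a) \<Rightarrow> ('a \<Rightarrow> 'a) \<Rightarrow> 'a \<Rightarrow> nat \<Rightarrow> 'a" and
  pcg_dir :: "('a::real_inner \<Rightarrow> 'a) \<Rightarrow> ('a \<Rightarrow> 'a) \<Rightarrow> 'a \<Rightarrow> nat \<Rightarrow> 'a"
where
  "pcg_res A B f 0 = f"
| "pcg_res A B f (Suc i) =
     pcg_res A B f i
       - pcg_alpha A (pcg_res A B f i) (pcg_dir A B f i) *\<^sub>R A (pcg_dir A B f i)"
| "pcg_dir A B f i =
     B (pcg_res A B f i)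
       + (\<Sum>j<i. pcg_beta A (B (pcg_res A B f i)) (pcg_dir A B f j) *\<^sub>R pcg_dir A B f j)"
  by pat_completeness auto
termination
  by (relation "Wellfounded.measure (case_sum (\<lambda>(_, _, _, i). 2 * i) (\<lambda>(_, _, _, i). 2 * i + 1))") auto

declare pcg_dir.simps [simp del]

primrec pcg_iter :: "('a::real_inner \<Rightarrow> 'a) \<Rightarrow> ('a \<Rightarrow> 'a) \<Rightarrow> 'a \<Rightarrow> nat \<Rightarrow> 'a" where
  "pcg_iter A B f 0 = 0"
| "pcg_iter A B f (Suc i) =
     pcg_iter A B f i
       + pcg_alpha A (pcg_res A B f i) (pcg_dir A B f i) *\<^sub>R pcg_dir A B f i"

definition npcg :: "nat \<Rightarrow> ('a::real_inner \<Rightarrow> 'a) \<Rightarrow> ('a \<Rightarrow> 'a) \<Rightarrow> 'a \<Rightarrow> 'a" where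
  "npcg n A B f = pcg_iter A B f n"

text \<open>The nonsymmetric nonlinear AMLI-cycle operator $\hat B_k^{ns}$. Levels are numbered from
  \<open>1\<close>; level \<open>0\<close> is unused.\<close>

fun amli_hat ::
    "(nat \<Rightarrow> 'a::real_inner set) \<Rightarrow> ('a \<Rightarrow> 'a) \<Rightarrow> (nat \<Rightarrow> 'a \<Rightarrow> 'a) \<Rightarrow> nat \<Rightarrow> nat \<Rightarrow> 'a \<Rightarrow> 'a"
where
  "amli_hat V A R n 0 = (\<lambda>f. 0)"
| "amli_hat V A R n (Suc 0) = inv_into (V 1) (level_op V A 1)"
| "amli_hat V A R n (Suc (Suc k)) =
     (\<lambda>f. let u1 = R (Suc (Suc k)) f in
        u1 + npcg n (level_op V A (Suc k)) (amli_hat V A R n (Suc k))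
               (proj_Q V (Suc k) (f - level_op V A (Suc (Suc k)) u1)))"

definition amli_tilde ::
    "(nat \<Rightarrow> 'a::real_inner set) \<Rightarrow> ('a \<Rightarrow> 'a) \<Rightarrow> (nat \<Rightarrow> 'a \<Rightarrow> 'a) \<Rightarrow> nat \<Rightarrow> nat \<Rightarrow> 'a \<Rightarrow> 'a"
where
  "amli_tilde V A R n k = npcg n (level_op V A k) (amli_hat V A R n k)"

lemma amli_hat_eq:
  assumes "k \<ge> 2"
  shows "amli_hat V A R n k f =
    (let u1 = R k f in
       u1 + amli_tilde V A R n (k - 1) (proj_Q V (k - 1) (f - level_op V A k u1)))"
proof -
  obtain m where "k = Suc (Suc m)"
    using assms by (metis Suc_le_D numeral_2_eq_2 Suc_le_mono)
  then show ?thesis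
    by (simp add: amli_tilde_def)
qed

end

theory Submission
  imports Defs
begin

text \<open>
  Write $a(u,v) = (u,v)_A$. In nonlinear PCG the directions are mutually $a$-orthogonal and the
  error $e_i = v - u_i$ is $a$-orthogonal to all earlier directions. Hence the step
  $e_{i+1} = e_i - \alpha_i p_i$ is at least as good as the plain preconditioned step
  $e_i - \hat B[r_i]$, and each step inherits the contraction factor $\delta$ of the preconditioner;
  $n$ steps give $\delta^n$.

  For the cycle, put $w = (I - R_kA_k)v$. Since $Q_{k-1}A_kw = A_{k-1}P_{k-1}w$, the error splits
  $a$-orthogonally into $(I-P_{k-1})w$ and the coarse PCG error of $P_{k-1}w$, so its squared norm is
  at most $(1-\delta^n)\|(I-P_{k-1})w\|^2 + \delta^n\|w\|^2 \le ((1-\delta^n)\bar\delta+\delta^n)\|v\|^2$,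
  by the two-grid bound and the convergence of the smoother.
\<close>

section \<open>The energy inner product\<close>

lemma spd_linear: "spd A \<Longrightarrow> linear A"
  by (simp add: spd_def)

text \<open>With the identity as operator, \<open>form\<close> is the ambient inner product, so the
  projection results for \<open>form A\<close> also cover \<open>proj_Q\<close> and the construction
  of \<open>level_op\<close>.\<close>

lemma spd_id: "spd (\<lambda>x::'a::real_inner. x)"
  unfolding spd_def using linear_ident by auto

lemma form_commute: "spd A \<Longrightarrow> form A u v = form A v u"
  by (metis spd_def form_def inner_commute)

lemma form_pos: "spd A \<Longrightarrow> v \<noteq> 0 \<Longrightarrow> 0 < form A v v"
  by (metis spd_def form_def)

lemma form_add_left: "spd A \<Longrightarrow> form A (u + v) w = form A u w + form A v w"
  by (simp add: form_def linear_add spd_linear inner_add_left)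

lemma form_diff_left: "spd A \<Longrightarrow> form A (u - v) w = form A u w - form A v w"
  by (simp add: form_def linear_diff spd_linear inner_diff_left)

lemma form_scale_left: "spd A \<Longrightarrow> form A (c *\<^sub>R u) w = c * form A u w"
  by (simp add: form_def linear_cmul spd_linear)

lemma form_zero_left: "spd A \<Longrightarrow> form A 0 w = 0"
  by (simp add: form_def linear_0 spd_linear)

lemma form_sum_left: "spd A \<Longrightarrow> form A (sum f I) w = (\<Sum>i\<in>I. form A (f i) w)"
  by (simp add: form_def linear_sum spd_linear inner_sum_left)

lemma form_add_right: "form A w (u + v) = form A w u + form A w v"
  by (simp add: form_def inner_add_right)

lemma form_diff_right: "form A w (u - v) = form A w u - form A w v"
  by (simp add: form_def inner_diff_right)

lemma form_scale_right: "form A w (c *\<^sub>R u) = c * form A w u"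
  by (simp add: form_def)

lemma form_zero_right: "form A w 0 = 0"
  by (simp add: form_def)

lemma form_sum_right: "form A w (sum f I) = (\<Sum>i\<in>I. form A w (f i))"
  by (simp add: form_def inner_sum_right)

lemmas form_linear =
  form_add_left form_diff_left form_scale_left form_zero_left form_sum_left
  form_add_right form_diff_right form_scale_right form_zero_right form_sum_right

lemma form_nonneg: "spd A \<Longrightarrow> 0 \<le> form A v v"
  by (cases "v = 0") (auto simp: form_zero_left dest: form_pos[of A v])

lemma form_eq_0_iff: "spd A \<Longrightarrow> form A v v = 0 \<longleftrightarrow> v = 0"
  by (metis form_pos form_zero_left less_irrefl)

lemma form_pythagoras:
  assumes "spd A" "form A x y = 0"
  shows "form A (x + y) (x + y) = form A x x + form A y y"
  using assms form_commute[OF assms(1), of x y] by (simp add: form_linear)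

text \<open>\<open>t e p\<close> is the exact line search: the remainder is orthogonal to
  \<open>p\<close>, so any other step length \<open>s\<close> only adds the energy of a multiple of
  \<open>p\<close>. For \<open>p = 0\<close> both sides coincide.\<close>

lemma form_line_search:
  assumes A: "spd A"
  defines "t \<equiv> \<lambda>e p. form A e p / form A p p"
  shows "form A (e - t e p *\<^sub>R p) (e - t e p *\<^sub>R p) \<le> form A (e - s *\<^sub>R p) (e - s *\<^sub>R p)"
proof (cases "p = 0")
  case False
  have pos: "0 < form A p p"
    by (rule form_pos[OF A False])
  have "form A (e - t e p *\<^sub>R p) p = 0"
    using pos by (simp add: t_def form_linear A)
  then have "form A (e - t e p *\<^sub>R p) ((t e p - s) *\<^sub>R p) = 0"
    by (simp add: form_scale_right)
  then have "form A (e - t e p *\<^sub>R p + (t e p - s) *\<^sub>R p) (e - t e p *\<^sub>R p + (t e p - s) *\<^sub>R p)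
      = form A (e - t e p *\<^sub>R p) (e - t e p *\<^sub>R p) + form A ((t e p - s) *\<^sub>R p) ((t e p - s) *\<^sub>R p)"
    by (rule form_pythagoras[OF A])
  moreover have "e - t e p *\<^sub>R p + (t e p - s) *\<^sub>R p = e - s *\<^sub>R p"
    by (simp add: algebra_simps)
  ultimately show ?thesis
    using form_nonneg[OF A, of "(t e p - s) *\<^sub>R p"] by simp
qed simp

section \<open>The energy norm: Cauchy-Schwarz and triangle inequality\<close>

lemma enorm_nonneg: "spd A \<Longrightarrow> 0 \<le> enorm A v"
  by (simp add: enorm_def form_nonneg)

lemma enorm_power2: "spd A \<Longrightarrow> (enorm A v)\<^sup>2 = form A v v"
  by (simp add: enorm_def form_nonneg)

lemma enorm_zero: "spd A \<Longrightarrow> enorm A 0 = 0"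
  by (simp add: enorm_def form_zero_left)

lemma enorm_pos: "spd A \<Longrightarrow> v \<noteq> 0 \<Longrightarrow> 0 < enorm A v"
  by (simp add: enorm_def form_pos)

lemma enorm_scale: "spd A \<Longrightarrow> enorm A (c *\<^sub>R v) = \<bar>c\<bar> * enorm A v"
  by (simp add: enorm_def form_scale_left form_scale_right real_sqrt_mult
      flip: mult.assoc power2_eq_square)

lemma form_Cauchy_Schwarz:
  assumes A: "spd A"
  shows "\<bar>form A u v\<bar> \<le> enorm A u * enorm A v"
proof (cases "v = 0")
  case False
  \<comment> \<open>This \<open>t\<close> minimises the energy of \<open>u - t v\<close>;
    nonnegativity of the minimum is the squared inequality.\<close>
  define t where "t = form A u v / form A v v"
  have pos: "0 < form A v v"
    by (rule form_pos[OF A False])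
  have "0 \<le> form A (u - t *\<^sub>R v) (u - t *\<^sub>R v)"
    by (rule form_nonneg[OF A])
  also have "\<dots> = form A u u - (form A u v)\<^sup>2 / form A v v"
    using pos form_commute[OF A, of v u]
    by (simp add: form_linear A t_def power2_eq_square)
  finally have "(form A u v)\<^sup>2 \<le> form A u u * form A v v"
    using pos by (simp add: field_simps)
  then have "\<bar>form A u v\<bar>\<^sup>2 \<le> (enorm A u * enorm A v)\<^sup>2"
    by (simp add: power_mult_distrib enorm_power2 A)
  then show ?thesis
    by (rule power2_le_imp_le) (simp add: enorm_nonneg A)
qed (simp add: form_zero_right enorm_zero A)

lemma enorm_triangle:
  assumes A: "spd A"
  shows "enorm A (u + v) \<le> enorm A u + enorm A v"
proof (rule power2_le_imp_le)
  have "(enorm A (u + v))\<^sup>2 = (enorm A u)\<^sup>2 + 2 * form A u v + (enorm A v)\<^sup>2"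
    using form_commute[OF A, of u v] by (simp add: enorm_power2 form_linear A)
  also have "\<dots> \<le> (enorm A u + enorm A v)\<^sup>2"
    using form_Cauchy_Schwarz[OF A, of u v] by (simp add: power2_sum)
  finally show "(enorm A (u + v))\<^sup>2 \<le> (enorm A u + enorm A v)\<^sup>2" .
qed (simp add: enorm_nonneg A)

lemma enorm_sum_le:
  assumes "spd A"
  shows "enorm A (sum f I) \<le> (\<Sum>i\<in>I. enorm A (f i))"
proof (induction I rule: infinite_finite_induct)
  case (insert i I)
  then show ?case
    using enorm_triangle[OF assms, of "f i" "sum f I"] by simp
qed (simp_all add: enorm_zero assms)

section \<open>Orthogonal bases and projections\<close>

lemma form_span_right:
  assumes "\<And>c. c \<in> C \<Longrightarrow> form A x c = 0" "s \<in> span C"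
  shows "form A x s = 0"
  using assms(2) by (induction rule: span_induct_alt) (simp_all add: form_linear assms(1))

text \<open>For a finite, pairwise \<open>form A\<close>-orthogonal \<open>C\<close> this is the
  energy projection onto \<open>span C\<close>. A zero vector in \<open>C\<close> contributes the
  term \<open>0\<close>, so orthogonal families may contain it.\<close>

definition fourier_sum :: "('a::real_inner \<Rightarrow> 'a) \<Rightarrow> 'a set \<Rightarrow> 'a \<Rightarrow> 'a" where
  "fourier_sum A C v = (\<Sum>c\<in>C. (form A v c / form A c c) *\<^sub>R c)"

lemma fourier_sum_in_span: "fourier_sum A C v \<in> span C"
  unfolding fourier_sum_def by (intro span_sum span_scale span_base)

lemma fourier_sum_orthogonal:
  assumes A: "spd A" and C: "finite C" "pairwise (\<lambda>x y. form A x y = 0) C" and s: "s \<in> span C"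
  shows "form A (v - fourier_sum A C v) s = 0"
proof (rule form_span_right[OF _ s])
  fix c assume c: "c \<in> C"
  have "form A (fourier_sum A C v) c = (\<Sum>d\<in>C. form A v d / form A d d * form A d c)"
    by (simp add: fourier_sum_def form_linear A)
  also have "\<dots> = (\<Sum>d\<in>C. if d = c then form A v d / form A d d * form A d c else 0)"
    using C(2) c by (intro sum.cong) (auto simp: pairwise_def)
  \<comment> \<open>For \<open>c = 0\<close> both sides are \<open>0\<close>; otherwise the
    denominator cancels.\<close>
  also have "\<dots> = form A v c"
    using C(1) c form_eq_0_iff[OF A, of c] by (auto simp: form_zero_right)
  finally show "form A (v - fourier_sum A C v) c = 0"
    by (simp add: form_diff_left A)
qed

text \<open>The remainder lies in \<open>span C\<close> and is orthogonal to \<open>span C\<close>,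
  hence to itself.\<close>

lemma fourier_sum_eq:
  assumes A: "spd A" and C: "finite C" "pairwise (\<lambda>x y. form A x y = 0) C" and v: "v \<in> span C"
  shows "fourier_sum A C v = v"
proof -
  have "v - fourier_sum A C v \<in> span C"
    by (intro span_diff v fourier_sum_in_span)
  then have "form A (v - fourier_sum A C v) (v - fourier_sum A C v) = 0"
    by (rule fourier_sum_orthogonal[OF A C])
  then show ?thesis
    by (simp add: form_eq_0_iff A)
qed

text \<open>Each new vector is replaced by its remainder after projection onto the span reached so
  far. The change lies in that span, so the total span stays the same.\<close>

lemma Gram_Schmidt_form:
  assumes A: "spd A" and "finite B"
  shows "\<exists>C. finite C \<and> span C = span B \<and> pairwise (\<lambda>x y. form A x y = 0) C"
  using assms(2)
proof (induction B)
  case (insert b B)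
  then obtain C where C: "finite C" "span C = span B" "pairwise (\<lambda>x y. form A x y = 0) C"
    by blast
  define b' where "b' = b - fourier_sum A C b"
  have "form A b' c = 0" if "c \<in> C" for c
    unfolding b'_def by (rule fourier_sum_orthogonal[OF A C(1,3) span_base[OF that]])
  then have "pairwise (\<lambda>x y. form A x y = 0) (insert b' C)"
    using C(3) form_commute[OF A] by (auto simp: pairwise_insert)
  moreover have "span (insert b' C) = span (insert b B)"
  proof -
    have "b' - b \<in> span C"
      by (simp add: b'_def fourier_sum_in_span span_neg)
    then have "span (insert b' C) = span (insert b C)"
      by (rule eq_span_insert_eq)
    then show ?thesis
      by (simp add: span_insert C(2))
  qed
  ultimately show ?case
    using C(1) by blast
qed (auto intro!: exI[of _ "{}"])

text \<open>A maximal independent subset of \<open>S\<close> spans \<open>S\<close> and is finite,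
  being bounded by a finite spanning set of the whole space; Gram-Schmidt then makes it
  orthogonal.\<close>

lemma subspace_orthogonal_basis:
  fixes S :: "'a::real_inner set"
  assumes fin: "\<exists>B::'a set. finite B \<and> span B = UNIV" and A: "spd A" and S: "subspace S"
  obtains C where "finite C" "span C = S" "pairwise (\<lambda>x y. form A x y = 0) C"
proof -
  obtain D :: "'a set" where D: "finite D" "span D = UNIV"
    using fin by blast
  obtain B where B: "B \<subseteq> S" "independent B" "S \<subseteq> span B"
    by (rule maximal_independent_subset)
  have "finite B"
    using independent_span_bound[OF D(1) B(2)] D(2) by simp
  moreover have "span B = S"
    using B S by (simp add: span_minimal subset_antisym)
  ultimately show ?thesis
    using Gram_Schmidt_form[OF A] that by metis
qed

text \<open>Shows that the definite description in \<open>orth_proj\<close> denotes: the Fourier sum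
  over an orthogonal basis is a solution, and two solutions differ by a vector of \<open>S\<close>
  orthogonal to \<open>S\<close>.\<close>

lemma orth_proj_form:
  fixes S :: "'a::real_inner set"
  assumes fin: "\<exists>B::'a set. finite B \<and> span B = UNIV" and A: "spd A" and S: "subspace S"
  shows orth_proj_in: "orth_proj (form A) S v \<in> S"
    and orth_proj_orthogonal: "s \<in> S \<Longrightarrow> form A (v - orth_proj (form A) S v) s = 0"
proof -
  obtain C where C: "finite C" "span C = S" "pairwise (\<lambda>x y. form A x y = 0) C"
    using subspace_orthogonal_basis[OF fin A S] .
  have "\<exists>!w. w \<in> S \<and> (\<forall>s\<in>S. form A (v - w) s = 0)"
  proof (rule ex1I[of _ "fourier_sum A C v"], intro conjI ballI)
    show "fourier_sum A C v \<in> S"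
      using fourier_sum_in_span C(2) by blast
    show "form A (v - fourier_sum A C v) s = 0" if "s \<in> S" for s
      using fourier_sum_orthogonal[OF A C(1,3)] C(2) that by blast
    fix w assume w: "w \<in> S \<and> (\<forall>s\<in>S. form A (v - w) s = 0)"
    let ?d = "w - fourier_sum A C v"
    have d: "?d \<in> S"
      using w S \<open>fourier_sum A C v \<in> S\<close> by (simp add: subspace_diff)
    have "form A ?d ?d = form A (v - fourier_sum A C v) ?d - form A (v - w) ?d"
      by (simp add: form_diff_left A)
    also have "\<dots> = 0"
      using w d \<open>\<And>s. s \<in> S \<Longrightarrow> form A (v - fourier_sum A C v) s = 0\<close> by simp
    finally show "w = fourier_sum A C v"
      by (simp add: form_eq_0_iff A)
  qed
  from theI'[OF this] show "orth_proj (form A) S v \<in> S"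
    and "s \<in> S \<Longrightarrow> form A (v - orth_proj (form A) S v) s = 0"
    unfolding orth_proj_def by auto
qed

section \<open>Linear operators on a subspace and their induced norm\<close>

lemma linear_op_on_sum:
  assumes T: "linear_op_on S T" and S: "subspace S" and "finite I" and "\<And>i. i \<in> I \<Longrightarrow> f i \<in> S"
  shows "T (\<Sum>i\<in>I. c i *\<^sub>R f i) = (\<Sum>i\<in>I. c i *\<^sub>R T (f i))"
  using assms(3,4)
proof (induction I)
  case empty
  have "T (0 *\<^sub>R 0) = 0 *\<^sub>R T 0"
    using T subspace_0[OF S] unfolding linear_op_on_def by blast
  then show ?case
    by simp
next
  case (insert i I)
  have "(\<Sum>i\<in>I. c i *\<^sub>R f i) \<in> S"
    using insert.prems S by (intro subspace_sum) (auto simp: subspace_scale)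
  moreover have "c i *\<^sub>R f i \<in> S"
    using insert.prems S by (simp add: subspace_scale)
  ultimately show ?case
    using insert T by (simp add: linear_op_on_def)
qed

lemma linear_op_on_zero: "linear_op_on S T \<Longrightarrow> subspace S \<Longrightarrow> T 0 = 0"
  using linear_op_on_sum[of S T "{}"] by simp

text \<open>Expanding \<open>v\<close> in an orthogonal basis reduces the bound to the finitely many
  images of basis vectors. It makes the set under the supremum in \<open>opnorm_on\<close>
  bounded.\<close>

lemma linear_op_on_bounded:
  fixes S :: "'a::real_inner set"
  assumes fin: "\<exists>B::'a set. finite B \<and> span B = UNIV" and A: "spd A" and S: "subspace S"
    and T: "linear_op_on S T"
  shows "\<exists>K. \<forall>v\<in>S. enorm A (T v) \<le> K * enorm A v"
proof -
  obtain C where C: "finite C" "span C = S" "pairwise (\<lambda>x y. form A x y = 0) C"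
    using subspace_orthogonal_basis[OF fin A S] .
  have "enorm A (T v) \<le> (\<Sum>c\<in>C. enorm A (T c) / enorm A c) * enorm A v" if v: "v \<in> S" for v
  proof -
    let ?t = "\<lambda>c. form A v c / form A c c"
    \<comment> \<open>Cauchy-Schwarz divided by the squared norm of \<open>c\<close>; for
      \<open>c = 0\<close> both sides are \<open>0\<close>.\<close>
    have coeff: "\<bar>?t c\<bar> \<le> enorm A v / enorm A c" for c
    proof (cases "c = 0")
      case False
      have "\<bar>?t c\<bar> = \<bar>form A v c\<bar> / (enorm A c)\<^sup>2"
        by (simp add: enorm_power2 A form_nonneg)
      also have "\<dots> \<le> enorm A v * enorm A c / (enorm A c)\<^sup>2"
        by (intro divide_right_mono form_Cauchy_Schwarz A) simp
      finally show ?thesis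
        using enorm_pos[OF A False] by (simp add: power2_eq_square)
    qed (simp add: form_zero_right enorm_zero A)
    have CS: "c \<in> S" if "c \<in> C" for c
      using C(2) span_base[OF that] by blast
    have "T v = T (\<Sum>c\<in>C. ?t c *\<^sub>R c)"
      using fourier_sum_eq[OF A C(1,3)] v C(2) by (simp add: fourier_sum_def)
    also have "\<dots> = (\<Sum>c\<in>C. ?t c *\<^sub>R T c)"
      by (rule linear_op_on_sum[OF T S C(1) CS])
    finally have "enorm A (T v) \<le> (\<Sum>c\<in>C. enorm A (?t c *\<^sub>R T c))"
      by (simp only: enorm_sum_le[OF A])
    also have "\<dots> \<le> (\<Sum>c\<in>C. enorm A v / enorm A c * enorm A (T c))"
      using coeff by (intro sum_mono) (simp only: enorm_scale[OF A] mult_right_mono enorm_nonneg[OF A])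
    also have "\<dots> = (\<Sum>c\<in>C. enorm A (T c) / enorm A c) * enorm A v"
      by (simp add: sum_distrib_left mult.commute)
    finally show ?thesis .
  qed
  then show ?thesis by blast
qed

text \<open>A real supremum dominates its members once the set is bounded above, which is where
  finite dimension enters; the quotient bound then gives the pointwise one.\<close>

lemma enorm_le_of_opnorm_on_le_1:
  fixes S :: "'a::real_inner set"
  assumes fin: "\<exists>B::'a set. finite B \<and> span B = UNIV" and A: "spd A" and S: "subspace S"
    and T: "linear_op_on S T" and le: "opnorm_on S (enorm A) T \<le> 1" and v: "v \<in> S"
  shows "enorm A (T v) \<le> enorm A v"
proof (cases "v = 0")
  case True
  then show ?thesis
    using linear_op_on_zero[OF T S] by simp
next
  case False
  obtain K where K: "\<And>v. v \<in> S \<Longrightarrow> enorm A (T v) \<le> K * enorm A v"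
    using linear_op_on_bounded[OF fin A S T] by blast
  have "bdd_above ((\<lambda>v. enorm A (T v) / enorm A v) ` S)"
  proof (rule bdd_aboveI2)
    fix u assume u: "u \<in> S"
    \<comment> \<open>The maximum with \<open>0\<close> covers \<open>u = 0\<close>, whose quotient
      is \<open>0\<close>, since \<open>K\<close> is not known to be nonnegative.\<close>
    show "enorm A (T u) / enorm A u \<le> max K 0"
    proof (cases "u = 0")
      case False
      then have "enorm A (T u) / enorm A u \<le> K"
        using K[OF u] enorm_pos[OF A False] by (simp add: divide_le_eq)
      then show ?thesis by simp
    qed (simp add: enorm_zero A)
  qed
  then have "enorm A (T v) / enorm A v \<le> opnorm_on S (enorm A) T"
    unfolding opnorm_on_def by (rule cSUP_upper[OF v])
  then have "enorm A (T v) / enorm A v \<le> 1"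
    using le by simp
  then show ?thesis
    using enorm_pos[OF A False] by (simp add: divide_le_eq)
qed

section \<open>Convergence of nonlinear PCG\<close>

text \<open>Isolates the variational property of \<open>level_op\<close>, so that PCG can be
  analysed on a single subspace without levels or definite descriptions.\<close>

definition galerkin_op :: "'a::real_inner set \<Rightarrow> ('a \<Rightarrow> 'a) \<Rightarrow> ('a \<Rightarrow> 'a) \<Rightarrow> bool" where
  "galerkin_op S A M \<longleftrightarrow> (\<forall>u\<in>S. M u \<in> S \<and> (\<forall>v\<in>S. M u \<bullet> v = form A u v))"

text \<open>On \<open>S\<close> the forms of \<open>M\<close> and \<open>A\<close> agree. All energy
  arguments are therefore carried out with the globally SPD operator \<open>A\<close>, as
  \<open>M\<close> is constrained only on \<open>S\<close>.\<close>

lemma galerkin_op_in: "galerkin_op S A M \<Longrightarrow> u \<in> S \<Longrightarrow> M u \<in> S"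
  and galerkin_op_inner: "galerkin_op S A M \<Longrightarrow> u \<in> S \<Longrightarrow> v \<in> S \<Longrightarrow> M u \<bullet> v = form A u v"
  and galerkin_op_form: "galerkin_op S A M \<Longrightarrow> u \<in> S \<Longrightarrow> v \<in> S \<Longrightarrow> form M u v = form A u v"
  by (auto simp: galerkin_op_def form_def)

lemma galerkin_op_enorm: "galerkin_op S A M \<Longrightarrow> u \<in> S \<Longrightarrow> enorm M u = enorm A u"
  by (simp add: enorm_def galerkin_op_form)

lemma subspace_eqI_inner:
  assumes "subspace S" "x \<in> S" "y \<in> S" "\<And>s. s \<in> S \<Longrightarrow> x \<bullet> s = y \<bullet> s"
  shows "x = y"
proof -
  have "(x - y) \<bullet> (x - y) = 0"
    using assms(4)[of "x - y"] subspace_diff[OF assms(1-3)] by (simp add: inner_diff_left)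
  then show ?thesis by simp
qed

lemma galerkin_op_linear:
  assumes A: "spd A" and S: "subspace S" and M: "galerkin_op S A M"
  shows "linear_op_on S M"
  unfolding linear_op_on_def
proof (intro conjI ballI allI)
  fix u v assume "u \<in> S" "v \<in> S"
  then show "M (u + v) = M u + M v"
    using S by (intro subspace_eqI_inner[OF S])
      (simp_all add: galerkin_op_in[OF M] galerkin_op_inner[OF M] subspace_add inner_add_left
        form_add_left[OF A])
next
  fix c v assume "v \<in> S"
  then show "M (c *\<^sub>R v) = c *\<^sub>R M v"
    using S by (intro subspace_eqI_inner[OF S])
      (simp_all add: galerkin_op_in[OF M] galerkin_op_inner[OF M] subspace_scale form_scale_left[OF A])
qed (rule galerkin_op_in[OF M])

lemma linear_op_on_diff_scale:
  assumes T: "linear_op_on S T" and S: "subspace S" and uv: "u \<in> S" "v \<in> S"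
  shows "T (u - c *\<^sub>R v) = T u - c *\<^sub>R T v"
proof -
  have "T (u + (- c) *\<^sub>R v) = T u + (- c) *\<^sub>R T v"
    using T uv subspace_scale[OF S uv(2), of "- c"] unfolding linear_op_on_def by metis
  then show ?thesis by simp
qed

text \<open>Makes the exact solve by \<open>inv_into\<close> on the coarsest level a left inverse
  there.\<close>

lemma galerkin_op_inj:
  assumes A: "spd A" and S: "subspace S" and M: "galerkin_op S A M"
  shows "inj_on M S"
proof (rule inj_onI)
  fix u v assume uv: "u \<in> S" "v \<in> S" "M u = M v"
  have "form A (u - v) (u - v) = M u \<bullet> (u - v) - M v \<bullet> (u - v)"
    using uv(1,2) S by (simp add: form_diff_left[OF A] galerkin_op_inner[OF M] subspace_diff)
  also have "\<dots> = 0"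
    using uv(3) by simp
  finally show "u = v"
    by (simp add: form_eq_0_iff A)
qed

text \<open>As \<open>B\<close> may be nonlinear, orthogonality of the directions comes from the
  explicit orthogonalisation against the whole history, hence the strong induction.\<close>

lemma npcg_invariants:
  fixes i :: nat
  assumes A: "spd A" and S: "subspace S" and M: "galerkin_op S A M"
    and B_in: "\<And>u. u \<in> S \<Longrightarrow> B (M u) \<in> S" and v: "v \<in> S"
  defines "p \<equiv> pcg_dir M B (M v)" and "r \<equiv> pcg_res M B (M v)"
    and "e \<equiv> \<lambda>i. v - pcg_iter M B (M v) i"
  shows "e i \<in> S \<and> r i = M (e i) \<and> p i \<in> S \<and>
     (\<forall>j<i. form A (e i) (p j) = 0 \<and> form A (p i) (p j) = 0)"
proof (induction i rule: less_induct)
  case (less i)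
  \<comment> \<open>Error and residual come first, because \<open>p i\<close> is built from
    \<open>B (r i)\<close>.\<close>
  have er: "e i \<in> S \<and> r i = M (e i) \<and> (\<forall>j<i. form A (e i) (p j) = 0)"
  proof (cases i)
    case 0
    then show ?thesis
      using v by (simp add: e_def r_def)
  next
    case (Suc m)
    let ?a = "pcg_alpha M (r m) (p m)"
    have IH: "e m \<in> S" "r m = M (e m)" "p m \<in> S"
      "\<And>j. j < m \<Longrightarrow> form A (e m) (p j) = 0" "\<And>j. j < m \<Longrightarrow> form A (p m) (p j) = 0"
      using less[of m] Suc by auto
    have e: "e i = e m - ?a *\<^sub>R p m"
      using Suc by (simp add: e_def r_def p_def)
    have r: "r i = r m - ?a *\<^sub>R M (p m)"
      using Suc by (simp add: r_def p_def)
    have "e i \<in> S"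
      unfolding e using IH S by (simp add: subspace_diff subspace_scale)
    moreover have "r i = M (e i)"
      unfolding e r using linear_op_on_diff_scale[OF galerkin_op_linear[OF A S M] S IH(1,3)] IH(2) by simp
    moreover have "form A (e i) (p j) = 0" if "j < i" for j
    proof (cases "j = m")
      case True
      \<comment> \<open>The line search makes the new error orthogonal to the newest direction; a
        vanishing denominator forces \<open>p m = 0\<close>, where orthogonality is trivial.\<close>
      have "?a = form A (e m) (p m) / form A (p m) (p m)"
        using IH by (simp add: pcg_alpha_def galerkin_op_inner[OF M] galerkin_op_form[OF M])
      then show ?thesis
        using form_eq_0_iff[OF A, of "p m"] True by (auto simp: e form_linear A)
    next
      case False
      with that Suc have "j < m"
          by simp
        with IH(4,5) show ?thesis
          unfolding e by (simp add: form_linear A)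
    qed
    ultimately show ?thesis by blast
  qed
  let ?b = "\<lambda>j. pcg_beta M (B (r i)) (p j)"
  have p: "p i = B (r i) + (\<Sum>j<i. ?b j *\<^sub>R p j)"
    unfolding p_def r_def by (subst pcg_dir.simps) (rule refl)
  have B: "B (r i) \<in> S"
    using er B_in by simp
  have pS: "p j \<in> S" if "j < i" for j
    using less[OF that] by blast
  have "p i \<in> S"
    unfolding p using B pS S by (intro subspace_add subspace_sum) (auto simp: subspace_scale)
  moreover have "form A (p i) (p j) = 0" if j: "j < i" for j
  proof -
    \<comment> \<open>The induction hypothesis compares a direction with earlier ones only; symmetry
      of the form covers the other order.\<close>
    have orth: "form A (p l) (p j) = 0" if "l < i" "l \<noteq> j" for l
    proof (cases "l < j")
      case True
      then show ?thesis
        using less[OF j] form_commute[OF A, of "p l" "p j"] by simp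
    next
      case False
      then show ?thesis
        using less[OF that(1)] that by simp
    qed
    have "(\<Sum>l<i. ?b l * form A (p l) (p j)) = (\<Sum>l<i. if l = j then ?b l * form A (p l) (p j) else 0)"
      using orth by (intro sum.cong) auto
    also have "\<dots> = ?b j * form A (p j) (p j)"
      using j by simp
    \<comment> \<open>\<open>pcg_beta\<close> is chosen for this cancellation; if
      \<open>p j = 0\<close>, both sides are \<open>0\<close> under the zero convention.\<close>
    also have "\<dots> = - form A (B (r i)) (p j)"
      using form_eq_0_iff[OF A, of "p j"] B pS[OF j]
      by (auto simp: pcg_beta_def galerkin_op_form[OF M] form_zero_right)
    finally show ?thesis
      by (simp add: p form_linear A)
  qed
  ultimately show ?case
    using er by blast
qed

text \<open>The exact step is compared with the unit step along \<open>p i\<close>, and that with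
  the plain preconditioned step, which contracts by \<open>contr\<close>; iterating gives the power
  of \<delta>.\<close>

lemma npcg_contraction:
  fixes n :: nat
  assumes A: "spd A" and S: "subspace S" and M: "galerkin_op S A M"
    and B_in: "\<And>u. u \<in> S \<Longrightarrow> B (M u) \<in> S" and v: "v \<in> S"
    and contr: "\<And>u. u \<in> S \<Longrightarrow> form A (u - B (M u)) (u - B (M u)) \<le> \<delta> * form A u u"
    and \<delta>: "0 \<le> \<delta>"
  shows "npcg n M B (M v) \<in> S"
    and "form A (v - npcg n M B (M v)) (v - npcg n M B (M v)) \<le> \<delta> ^ n * form A v v"
proof -
  define p r e where "p = pcg_dir M B (M v)" and "r = pcg_res M B (M v)"
    and "e = (\<lambda>i. v - pcg_iter M B (M v) i)"
  have inv: "e i \<in> S" "r i = M (e i)" "p i \<in> S"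
    "\<And>j. j < i \<Longrightarrow> form A (e i) (p j) = 0" "\<And>j. j < i \<Longrightarrow> form A (p i) (p j) = 0" for i
    using npcg_invariants[where B = B, OF A S M B_in v, of i] unfolding p_def r_def e_def by auto
  have step: "form A (e (Suc i)) (e (Suc i)) \<le> \<delta> * form A (e i) (e i)" for i
  proof -
    \<comment> \<open>\<open>?q\<close> collects the earlier directions contained in
      \<open>p i\<close>. Both \<open>e i\<close> and \<open>p i\<close> are orthogonal to it, so
      adding it to \<open>e i - p i\<close> can only increase the energy.\<close>
    let ?q = "\<Sum>j<i. pcg_beta M (B (r i)) (p j) *\<^sub>R p j"
    have "pcg_alpha M (r i) (p i) = form A (e i) (p i) / form A (p i) (p i)"
      using inv by (simp add: pcg_alpha_def galerkin_op_inner[OF M] galerkin_op_form[OF M])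
    then have "e (Suc i) = e i - (form A (e i) (p i) / form A (p i) (p i)) *\<^sub>R p i"
      by (simp add: e_def r_def p_def)
    then have "form A (e (Suc i)) (e (Suc i)) \<le> form A (e i - 1 *\<^sub>R p i) (e i - 1 *\<^sub>R p i)"
      using form_line_search[OF A, of "e i" "p i" 1] by metis
    also have "\<dots> \<le> form A (e i - p i) (e i - p i) + form A ?q ?q"
      by (simp add: form_nonneg A)
    also have "\<dots> = form A (e i - p i + ?q) (e i - p i + ?q)"
    proof (rule form_pythagoras[OF A, symmetric])
      show "form A (e i - p i) ?q = 0"
        using inv by (simp add: form_sum_right form_scale_right form_diff_left A)
    qed
    also have "e i - p i + ?q = e i - B (M (e i))"
    proof -
      have "p i = B (r i) + ?q"
        unfolding p_def r_def by (subst pcg_dir.simps) (rule refl)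
      then show ?thesis
        by (simp add: inv(2))
    qed
    also have "form A (e i - B (M (e i))) (e i - B (M (e i))) \<le> \<delta> * form A (e i) (e i)"
      by (rule contr[OF inv(1)])
    finally show ?thesis .
  qed
  have "form A (e n) (e n) \<le> \<delta> ^ n * form A v v"
  proof (induction n)
    case 0
    then show ?case by (simp add: e_def)
  next
    case (Suc n)
    have "\<delta> * form A (e n) (e n) \<le> \<delta> * (\<delta> ^ n * form A v v)"
      using Suc \<delta> by (rule mult_left_mono)
    then show ?case
      using step[of n] by simp
  qed
  then show "form A (v - npcg n M B (M v)) (v - npcg n M B (M v)) \<le> \<delta> ^ n * form A v v"
    by (simp add: e_def npcg_def)
  have "v - e n \<in> S"
    using S v inv(1) by (simp add: subspace_diff)
  then show "npcg n M B (M v) \<in> S"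
    by (simp add: e_def npcg_def)
qed

section \<open>The multilevel recursion\<close>

text \<open>The vector described in \<open>level_op\<close> exists and is unique: it is the ambient
  orthogonal projection of \<open>A u\<close> onto \<open>V k\<close>.\<close>

lemma level_op_galerkin:
  fixes V :: "nat \<Rightarrow> 'a::real_inner set"
  assumes fin: "\<exists>B::'a set. finite B \<and> span B = UNIV" and S: "subspace (V k)"
  shows "galerkin_op (V k) A (level_op V A k)"
proof -
  have "\<exists>!w. w \<in> V k \<and> (\<forall>v\<in>V k. w \<bullet> v = form A u v)" for u
  proof -
    let ?w = "orth_proj (form (\<lambda>x. x)) (V k) (A u)"
    have w: "?w \<in> V k"
      by (rule orth_proj_in[OF fin spd_id S])
    have inner: "?w \<bullet> v = form A u v" if "v \<in> V k" for v
      using orth_proj_orthogonal[OF fin spd_id S that, of "A u"] by (simp add: form_def inner_diff_left)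
    show ?thesis
    proof (rule ex1I[of _ ?w])
      show "?w \<in> V k \<and> (\<forall>v\<in>V k. ?w \<bullet> v = form A u v)"
        using w inner by blast
      show "x = ?w" if "x \<in> V k \<and> (\<forall>v\<in>V k. x \<bullet> v = form A u v)" for x
        using that inner by (intro subspace_eqI_inner[OF S _ w]) auto
    qed
  qed
  from theI'[OF this] show ?thesis
    unfolding galerkin_op_def level_op_def by blast
qed

text \<open>Tested against \<open>V j\<close>, both sides give \<open>form A w s\<close>. Thus the
  restricted residual of an error \<open>w\<close> is the coarse right-hand side whose exact
  solution is the energy projection of \<open>w\<close>.\<close>

lemma proj_Q_level_op:
  fixes V :: "nat \<Rightarrow> 'a::real_inner set"
  assumes fin: "\<exists>B::'a set. finite B \<and> span B = UNIV" and A: "spd A"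
    and S: "subspace (V k)" "subspace (V j)" and sub: "V j \<subseteq> V k" and w: "w \<in> V k"
  shows "proj_Q V j (level_op V A k w) = level_op V A j (proj_P V A j w)"
proof (rule subspace_eqI_inner[OF S(2)])
  have inner: "(\<bullet>) = form (\<lambda>x::'a. x)"
    by (simp add: fun_eq_iff form_def)
  note Mj = level_op_galerkin[of V j A, OF fin S(2)] and Mk = level_op_galerkin[of V k A, OF fin S(1)]
  note Q = orth_proj_form[OF fin spd_id S(2), folded inner]
  note P = orth_proj_form[OF fin A S(2)]
  show "proj_Q V j (level_op V A k w) \<in> V j"
    unfolding proj_Q_def by (rule Q)
  show "level_op V A j (proj_P V A j w) \<in> V j"
    unfolding proj_P_def by (intro galerkin_op_in[OF Mj] P)
  fix s assume s: "s \<in> V j"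
  have "proj_Q V j (level_op V A k w) \<bullet> s = level_op V A k w \<bullet> s"
    using Q(2)[OF s] by (simp add: proj_Q_def inner_diff_left)
  also have "\<dots> = form A w s"
    using galerkin_op_inner[OF Mk w] s sub by blast
  also have "\<dots> = form A (proj_P V A j w) s"
    using P(2)[OF s] by (simp add: proj_P_def form_diff_left A)
  also have "\<dots> = level_op V A j (proj_P V A j w) \<bullet> s"
    using galerkin_op_inner[OF Mj _ s] P(1) by (simp add: proj_P_def)
  finally show "proj_Q V j (level_op V A k w) \<bullet> s = level_op V A j (proj_P V A j w) \<bullet> s" .
qed

lemma smoother_error_linear:
  fixes V :: "nat \<Rightarrow> 'a::real_inner set"
  assumes fin: "\<exists>B::'a set. finite B \<and> span B = UNIV" and A: "spd A"
    and S: "subspace (V k)" and R: "linear_op_on (V k) (R k)"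
  shows "linear_op_on (V k) (smoother_error V A R k)"
  using galerkin_op_linear[OF A S level_op_galerkin[where V = V, OF fin S]] R
  unfolding linear_op_on_def smoother_error_def
  by (simp add: subspace_diff[OF S] scaleR_diff_right)

text \<open>Induction on the level: contraction of the coarse preconditioner by \<delta> gives
  contraction of the coarse PCG by \<open>\<delta> ^ n\<close>, and the inequality on \<delta>
  returns the same factor one level up. Membership of the error is carried along because PCG needs
  preconditioned residuals in the subspace.\<close>

lemma amli_hat_contraction:
  fixes V :: "nat \<Rightarrow> 'a::real_inner set"
  assumes fin: "\<exists>B::'a set. finite B \<and> span B = UNIV" and A: "spd A"
    and subsp: "\<And>k. 1 \<le> k \<Longrightarrow> k \<le> J \<Longrightarrow> subspace (V k)"
    and nested: "\<And>k. 1 \<le> k \<Longrightarrow> k < J \<Longrightarrow> V k \<subseteq> V (Suc k)"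
    and R_linear: "\<And>k. 2 \<le> k \<Longrightarrow> k \<le> J \<Longrightarrow> linear_op_on (V k) (R k)"
    and smooth: "\<And>k v. 2 \<le> k \<Longrightarrow> k \<le> J \<Longrightarrow> v \<in> V k \<Longrightarrow>
      form A (smoother_error V A R k v) (smoother_error V A R k v) \<le> form A v v"
    and two_grid: "\<And>k v. 2 \<le> k \<Longrightarrow> k \<le> J \<Longrightarrow> v \<in> V k \<Longrightarrow>
      form A (two_grid_error V A R k v) (two_grid_error V A R k v) \<le> \<delta>b * form A v v"
    and \<delta>: "0 \<le> \<delta>" "\<delta> < 1" "(1 - \<delta> ^ n) * \<delta>b + \<delta> ^ n \<le> \<delta>"
    and k: "1 \<le> k" "k \<le> J" and v: "v \<in> V k"
  defines "e \<equiv> \<lambda>k v. v - amli_hat V A R n k (level_op V A k v)"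
  shows "e k v \<in> V k \<and> form A (e k v) (e k v) \<le> \<delta> * form A v v"
  using k(1) k(2) v
proof (induction k arbitrary: v rule: nat_induct_at_least)
  case base
  \<comment> \<open>The coarsest solve is exact, so the error is zero.\<close>
  have "inj_on (level_op V A 1) (V 1)"
    using base.prems subsp by (intro galerkin_op_inj[OF A] level_op_galerkin fin) auto
  then have "e 1 v = 0"
    using base.prems by (simp add: e_def)
  then show ?case
    using base.prems subsp \<delta> by (simp add: form_nonneg form_zero_left A subspace_0)
next
  case (Suc k)
  let ?M = "level_op V A (Suc k)" and ?m = "level_op V A k"
  have bounds: "2 \<le> Suc k" "Suc k \<le> J" "1 \<le> k" "k \<le> J" "k < J"
    using Suc by auto
  have Sk: "subspace (V (Suc k))" "subspace (V k)" and sub: "V k \<subseteq> V (Suc k)"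
    using subsp nested bounds by auto
  note M = level_op_galerkin[of V "Suc k" A, OF fin Sk(1)]
    and m = level_op_galerkin[of V k A, OF fin Sk(2)]
  note R = R_linear[OF bounds(1,2)]
  let ?w = "smoother_error V A R (Suc k) v"
  let ?x = "proj_P V A k ?w"
  let ?c = "amli_tilde V A R n k (?m ?x)"
  have w: "?w \<in> V (Suc k)"
    using smoother_error_linear[where V = V and R = R, OF fin A Sk(1) R] Suc.prems by (simp add: linear_op_on_def)
  have x: "?x \<in> V k"
    unfolding proj_P_def by (rule orth_proj_in[OF fin A Sk(2)])
  have hat_in: "amli_hat V A R n k (?m u) \<in> V k" if "u \<in> V k" for u
  proof -
    have "u - e k u \<in> V k"
      using Suc.IH[OF bounds(4) that] that Sk by (simp add: subspace_diff)
    then show ?thesis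
      by (simp add: e_def)
  qed
  have c: "?c \<in> V k" "form A (?x - ?c) (?x - ?c) \<le> \<delta> ^ n * form A ?x ?x"
    unfolding amli_tilde_def
    using npcg_contraction[where B = "amli_hat V A R n k" and n = n, OF A Sk(2) m hat_in x _ \<delta>(1)] Suc.IH[OF bounds(4)]
    by (simp_all add: e_def)
  have Mv: "?M v \<in> V (Suc k)"
    by (rule galerkin_op_in[OF M Suc.prems(2)])
  have RMv: "R (Suc k) (?M v) \<in> V (Suc k)"
    using R Mv by (simp add: linear_op_on_def)
  \<comment> \<open>By linearity the residual after smoothing is the level operator applied to the
    smoothed error.\<close>
  have "?M v - ?M (R (Suc k) (?M v)) = ?M ?w"
    using linear_op_on_diff_scale[OF galerkin_op_linear[OF A Sk(1) M] Sk(1) Suc.prems(2) RMv, of 1]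
    by (simp add: smoother_error_def)
  then have "e (Suc k) v = ?w - amli_tilde V A R n k (proj_Q V k (?M ?w))"
    using amli_hat_eq[OF bounds(1), of V A R n "?M v"]
    by (simp add: e_def Let_def smoother_error_def)
  also have "\<dots> = ?w - ?c"
    using proj_Q_level_op[OF fin A Sk sub w] by simp
  finally have e: "e (Suc k) v = ?w - ?c" .
  have "e (Suc k) v \<in> V (Suc k)"
    unfolding e using w c(1) sub Sk by (auto intro: subspace_diff)
  moreover have "form A (e (Suc k) v) (e (Suc k) v) \<le> \<delta> * form A v v"
  proof -
    \<comment> \<open>\<open>?y\<close> is the two-grid error, orthogonal to \<open>V k\<close> and
      hence to the coarse PCG error.\<close>
    let ?y = "?w - ?x"
    have orth: "form A ?y s = 0" if "s \<in> V k" for s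
      unfolding proj_P_def by (rule orth_proj_orthogonal[OF fin A Sk(2) that])
    have split_w: "form A ?w ?w = form A ?y ?y + form A ?x ?x"
      using form_pythagoras[OF A orth[OF x]] by simp
    have "form A ?y (?x - ?c) = 0"
      using orth x c(1) Sk(2) by (simp add: subspace_diff)
    from form_pythagoras[OF A this]
    have "form A (e (Suc k) v) (e (Suc k) v) = form A ?y ?y + form A (?x - ?c) (?x - ?c)"
      by (simp add: e)
    also have "\<dots> \<le> form A ?y ?y + \<delta> ^ n * form A ?x ?x"
      using c(2) by simp
    \<comment> \<open>Eliminating \<open>?x\<close> leaves a convex combination of the energies of
      \<open>?y\<close> and \<open>?w\<close>, which the two-grid and smoothing bounds control
      separately.\<close>
    also have "\<dots> = (1 - \<delta> ^ n) * form A ?y ?y + \<delta> ^ n * form A ?w ?w"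
      unfolding split_w by (simp add: algebra_simps)
    also have "\<dots> \<le> (1 - \<delta> ^ n) * (\<delta>b * form A v v) + \<delta> ^ n * form A v v"
    proof (intro add_mono mult_left_mono)
      show "form A ?y ?y \<le> \<delta>b * form A v v"
        using two_grid[OF bounds(1,2) Suc.prems(2)] by (simp add: two_grid_error_def Let_def)
      show "form A ?w ?w \<le> form A v v"
        by (rule smooth[OF bounds(1,2) Suc.prems(2)])
    qed (use \<delta> in \<open>auto simp: power_le_one\<close>)
    also have "\<dots> = ((1 - \<delta> ^ n) * \<delta>b + \<delta> ^ n) * form A v v"
      by (simp add: algebra_simps)
    also have "\<dots> \<le> \<delta> * form A v v"
      by (intro mult_right_mono \<delta>(3) form_nonneg A)
    finally show ?thesis .
  qed
  ultimately show ?case by blast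
qed

text \<open>Factoring \<open>1 - \<delta> ^ n\<close> reduces the inequality to
  \<open>1 \<le> (1 - \<delta>b) * (\<Sum>i<n. \<delta> ^ i)\<close>; each of the \<open>n\<close>
  summands is at least \<open>\<delta> ^ n\<close>.\<close>

lemma contraction_factor_exists:
  fixes \<delta>b :: real
  assumes "0 \<le> \<delta>b" "\<delta>b < 1" and n: "n \<ge> 1" "real n > 1 / (1 - \<delta>b)"
  shows "\<exists>\<delta>. 0 \<le> \<delta> \<and> \<delta> < 1 \<and> (1 - \<delta> ^ n) * \<delta>b + \<delta> ^ n \<le> \<delta>"
proof -
  have gt: "real n * (1 - \<delta>b) > 1"
    using n assms by (simp add: field_simps)
  \<comment> \<open>Solves \<open>n * \<delta> ^ n * (1 - \<delta>b) = 1\<close>; the hypothesis on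
    \<open>n\<close> puts the root below \<open>1\<close>.\<close>
  define \<delta> where "\<delta> = root n (1 / (real n * (1 - \<delta>b)))"
  have pow: "\<delta> ^ n = 1 / (real n * (1 - \<delta>b))"
    unfolding \<delta>_def using n gt by (intro real_root_pow_pos2) auto
  have \<delta>: "0 \<le> \<delta>" "\<delta> < 1"
    unfolding \<delta>_def using n gt by auto
  have "1 / (1 - \<delta>b) = real n * \<delta> ^ n"
    using n by (simp add: pow)
  also have "\<dots> = (\<Sum>i<n. \<delta> ^ n)"
    by simp
  also have "\<dots> \<le> (\<Sum>i<n. \<delta> ^ i)"
    using \<delta> by (intro sum_mono power_decreasing) auto
  finally have "1 \<le> (1 - \<delta>b) * (\<Sum>i<n. \<delta> ^ i)"
    using gt \<open>\<delta>b < 1\<close> by (simp add: pow divide_le_eq mult.commute)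
  then have "(1 - \<delta>) * 1 \<le> (1 - \<delta>) * ((1 - \<delta>b) * (\<Sum>i<n. \<delta> ^ i))"
    using \<delta> by (intro mult_left_mono) auto
  also have "\<dots> = (1 - \<delta>b) * (1 - \<delta> ^ n)"
    by (simp add: one_diff_power_eq)
  finally have "(1 - \<delta> ^ n) * \<delta>b + \<delta> ^ n \<le> \<delta>"
    by (simp add: algebra_simps)
  then show ?thesis
    using \<delta> by blast
qed

theorem theorem3p16:
  fixes V :: "nat \<Rightarrow> 'a::real_inner set"
    and A :: "'a \<Rightarrow> 'a"
    and R :: "nat \<Rightarrow> 'a \<Rightarrow> 'a"
    and J n :: nat
    and \<delta>b :: real
  assumes fin_dim: "\<exists>B::'a set. finite B \<and> span B = UNIV"
    and A_spd: "spd A"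
    and J: "J \<ge> 1"
    and subsp: "\<And>k. 1 \<le> k \<Longrightarrow> k \<le> J \<Longrightarrow> subspace (V k)"
    and nested: "\<And>k. 1 \<le> k \<Longrightarrow> k < J \<Longrightarrow> V k \<subseteq> V (Suc k)"
    and V_top: "V J = UNIV"
    and R_linear: "\<And>k. 2 \<le> k \<Longrightarrow> k \<le> J \<Longrightarrow> linear_op_on (V k) (R k)"
    and R_convergent: "\<And>k. 2 \<le> k \<Longrightarrow> k \<le> J \<Longrightarrow>
           opnorm_on (V k) (enorm (level_op V A k)) (smoother_error V A R k) < 1"
    and \<delta>b: "0 \<le> \<delta>b" "\<delta>b < 1"
    and two_grid: "\<And>k v. 2 \<le> k \<Longrightarrow> k \<le> J \<Longrightarrow> v \<in> V k \<Longrightarrow>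
           (enorm (level_op V A k) (two_grid_error V A R k v))\<^sup>2
             \<le> \<delta>b * (enorm (level_op V A k) v)\<^sup>2"
    and n: "n \<ge> 1"
  shows "(real n > 1 / (1 - \<delta>b) \<longrightarrow> (\<exists>\<delta>. 0 \<le> \<delta> \<and> \<delta> < 1 \<and> (1 - \<delta> ^ n) * \<delta>b + \<delta> ^ n \<le> \<delta>))
    \<and> (\<forall>\<delta>. 0 \<le> \<delta> \<and> \<delta> < 1 \<and> (1 - \<delta> ^ n) * \<delta>b + \<delta> ^ n \<le> \<delta> \<longrightarrow>
         (\<forall>k\<in>{1..J}. \<forall>v\<in>V k.
            (enorm (level_op V A k) (v - amli_hat V A R n k (level_op V A k v)))\<^sup>2
              \<le> \<delta> * (enorm (level_op V A k) v)\<^sup>2 \<and>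
            (enorm (level_op V A k) (v - amli_tilde V A R n k (level_op V A k v)))\<^sup>2
              \<le> \<delta> ^ n * (enorm (level_op V A k) v)\<^sup>2))"
proof (intro conjI impI allI ballI)
  assume "real n > 1 / (1 - \<delta>b)"
  then show "\<exists>\<delta>. 0 \<le> \<delta> \<and> \<delta> < 1 \<and> (1 - \<delta> ^ n) * \<delta>b + \<delta> ^ n \<le> \<delta>"
    using contraction_factor_exists \<delta>b n by blast
next
  fix \<delta> :: real and k v
  assume \<delta>: "0 \<le> \<delta> \<and> \<delta> < 1 \<and> (1 - \<delta> ^ n) * \<delta>b + \<delta> ^ n \<le> \<delta>"
    and "k \<in> {1..J}" and v: "v \<in> V k"
  then have k: "1 \<le> k" "k \<le> J" by auto
  note Sk = subsp[OF k]
  have M: "galerkin_op (V k) A (level_op V A k)" if "1 \<le> k" "k \<le> J" for k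
    by (rule level_op_galerkin[where V = V, OF fin_dim subsp[OF that]])
  have energy: "(enorm (level_op V A k) u)\<^sup>2 = form A u u" if "1 \<le> k" "k \<le> J" "u \<in> V k" for k u
    using galerkin_op_enorm[OF M[OF that(1,2)] that(3)] enorm_power2[OF A_spd] by simp
  have E_linear: "linear_op_on (V k) (smoother_error V A R k)" if "2 \<le> k" "k \<le> J" for k
    using smoother_error_linear[OF fin_dim A_spd] subsp R_linear that by simp
  have E_in: "smoother_error V A R k u \<in> V k" if "2 \<le> k" "k \<le> J" "u \<in> V k" for k u
    using E_linear[OF that(1,2)] that(3) by (simp add: linear_op_on_def)
  have smooth: "form A (smoother_error V A R k u) (smoother_error V A R k u) \<le> form A u u"
    if ku: "2 \<le> k" "k \<le> J" "u \<in> V k" for k u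
  proof -
    \<comment> \<open>The two induced norms agree because the smoother error stays in
      \<open>V k\<close>.\<close>
    have "opnorm_on (V k) (enorm A) (smoother_error V A R k)
        = opnorm_on (V k) (enorm (level_op V A k)) (smoother_error V A R k)"
      unfolding opnorm_on_def using ku E_in
      by (intro SUP_cong refl) (simp add: galerkin_op_enorm[OF M])
    then have "enorm A (smoother_error V A R k u) \<le> enorm A u"
      using R_convergent[OF ku(1,2)] subsp ku
      by (intro enorm_le_of_opnorm_on_le_1[OF fin_dim A_spd _ E_linear]) auto
    then show ?thesis
      using power_mono[OF _ enorm_nonneg[OF A_spd]] enorm_power2[OF A_spd] by metis
  qed
  have two_grid': "form A (two_grid_error V A R k u) (two_grid_error V A R k u) \<le> \<delta>b * form A u u"
    if ku: "2 \<le> k" "k \<le> J" "u \<in> V k" for k u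
  proof -
    \<comment> \<open>Nestedness keeps the two-grid error in \<open>V k\<close>, where the level
      norm may be replaced by the energy norm of \<open>A\<close>.\<close>
    have "V (k - 1) \<subseteq> V k"
      using nested[of "k - 1"] ku by simp
    moreover have "proj_P V A (k - 1) (smoother_error V A R k u) \<in> V (k - 1)"
      unfolding proj_P_def using subsp ku by (intro orth_proj_in[OF fin_dim A_spd]) auto
    ultimately have "two_grid_error V A R k u \<in> V k"
      using E_in[OF ku] subsp ku by (auto simp: two_grid_error_def Let_def intro!: subspace_diff)
    then show ?thesis
      using two_grid[OF ku] energy ku by simp
  qed
  have hat: "u - amli_hat V A R n k (level_op V A k u) \<in> V k"
    "form A (u - amli_hat V A R n k (level_op V A k u)) (u - amli_hat V A R n k (level_op V A k u))
      \<le> \<delta> * form A u u" if "u \<in> V k" for u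
    using amli_hat_contraction[OF fin_dim A_spd subsp nested R_linear smooth two_grid' _ _ _ k that]
      \<delta> by blast+
  have hat_in: "amli_hat V A R n k (level_op V A k u) \<in> V k" if "u \<in> V k" for u
    using subspace_diff[OF Sk that hat(1)[OF that]] by simp
  show "(enorm (level_op V A k) (v - amli_hat V A R n k (level_op V A k v)))\<^sup>2
      \<le> \<delta> * (enorm (level_op V A k) v)\<^sup>2"
    unfolding energy[OF k hat(1)[OF v]] energy[OF k v] by (rule hat(2)[OF v])
  \<comment> \<open>One more use of the PCG estimate, now on level \<open>k\<close> itself with the
    contraction just obtained.\<close>
  have tilde: "amli_tilde V A R n k (level_op V A k v) \<in> V k"
    "form A (v - amli_tilde V A R n k (level_op V A k v)) (v - amli_tilde V A R n k (level_op V A k v))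
      \<le> \<delta> ^ n * form A v v"
    unfolding amli_tilde_def
    using npcg_contraction[where B = "amli_hat V A R n k" and n = n, OF A_spd Sk M[OF k] hat_in v hat(2)] \<delta> by blast+
  show "(enorm (level_op V A k) (v - amli_tilde V A R n k (level_op V A k v)))\<^sup>2
      \<le> \<delta> ^ n * (enorm (level_op V A k) v)\<^sup>2"
    unfolding energy[OF k subspace_diff[OF Sk v tilde(1)]] energy[OF k v] by (rule tilde(2))
qed

end
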